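(* Let $k\ge 1$ and let $\mathcal{C}$ be a conjugacy class in $A_n$. Suppose that the elements of $\mathcal{C}$ are products of $k$ quads with disjoint supports. Then: (1) if $n=4k$, the graph $\Gamma(\mathcal{C})$ is connected; (2) if $n \ge 4k+2$, the graph $\Gamma(\mathcal{C})$ is connected; (3) if $n= 4k+1$, the graph $\Gamma(\mathcal{C})$ has $n$ connected components, and one of these is $\mathcal{C} \cap A_{n-1}$.
   Context: A quad is a permutation of the form $(a\,b)(c\,d)$ with $a,b,c,d$ distinct. $A_{n-1}$ is viewed as the subgroup of $A_n$ (acting on $\{1,\dots,n\}$) fixing the point $n$. For a conjugacy class $\mathcal{C}$ of a group $G$, $\Gamma(\mathcal{C})$ is the graph whose vertices are the elements of $\mathcal{C}$, two vertices $x,y$ being joined by an edge if $x$ and $y$ commute and either $xy^{-1}\in\mathcal{C}$ or $yx^{-1}\in\mathcal{C}$. *)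

theory Defs
  imports "HOL-Algebra.Sym_Groups" "HOL-Algebra.Group_Action"
    "Graph_Theory.Digraph_Component"
begin

definition quad :: "('a \<Rightarrow> 'a) \<Rightarrow> bool" where
  "quad p \<longleftrightarrow>
    (\<exists>a b c d. distinct [a, b, c, d] \<and> p = transpose a b \<circ> transpose c d)"

definition perm_supp :: "('a \<Rightarrow> 'a) \<Rightarrow> 'a set" where
  "perm_supp p = {x. p x \<noteq> x}"

text \<open>
  If \<open>p\<close> permutes a set, then disjointness of the supports forces each quad of the list to
  permute that set too, so no bound on the points moved by the quads is needed.
\<close>
definition disjoint_quad_product :: "nat \<Rightarrow> ('a \<Rightarrow> 'a) \<Rightarrow> bool" where
  "disjoint_quad_product k p \<longleftrightarrow>
    (\<exists>qs. length qs = k \<and> (\<forall>q\<in>set qs. quad q) \<and>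
      sorted_wrt (\<lambda>q r. perm_supp q \<inter> perm_supp r = {}) qs \<and>
      p = foldr (\<circ>) qs id)"

definition conjugacy_classes :: "('a, 'b) monoid_scheme \<Rightarrow> 'a set set" where
  "conjugacy_classes G =
    orbits G (carrier G) (\<lambda>g. \<lambda>h\<in>carrier G. g \<otimes>\<^bsub>G\<^esub> h \<otimes>\<^bsub>G\<^esub> inv\<^bsub>G\<^esub> g)"

text \<open>
  The undirected graph \<open>\<Gamma>(C)\<close>, encoded as a symmetric digraph. The condition
  \<open>x \<noteq> y\<close> only matters for \<open>C = {\<one>}\<close>, where it excludes a loop.
\<close>
definition class_graph :: "('a, 'b) monoid_scheme \<Rightarrow> 'a set \<Rightarrow> 'a pair_pre_digraph" where
  "class_graph G C =
    \<lparr> pverts = C,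
      parcs = {(x, y). x \<in> C \<and> y \<in> C \<and> x \<noteq> y \<and> x \<otimes>\<^bsub>G\<^esub> y = y \<otimes>\<^bsub>G\<^esub> x \<and>
        (x \<otimes>\<^bsub>G\<^esub> inv\<^bsub>G\<^esub> y \<in> C \<or> y \<otimes>\<^bsub>G\<^esub> inv\<^bsub>G\<^esub> x \<in> C)} \<rparr>"

lemma class_graph_bidirected: "pair_bidirected_digraph (class_graph G C)"
  by unfold_locales (auto simp: class_graph_def symmetric_def sym_def arcs_ends_def arc_to_ends_def)

text \<open>
  Since \<open>class_graph G C\<close> is symmetric, its strongly connected components are the
  connected components of the undirected graph, here given by their vertex sets.
\<close>
definition component_verts :: "'a pair_pre_digraph \<Rightarrow> 'a set set" where
  "component_verts H = pre_digraph.sccs_verts (with_proj H)"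

lemma alt_group_pred_carrier:
  assumes "n \<ge> 1"
  shows "carrier (alt_group (n - 1)) = {p \<in> carrier (alt_group n). p n = n}"
proof -
  have *: "{1..n-1} \<subseteq> {1..n}" "n \<notin> {1..n-1}" "{1..n} - {1..n-1} = {n}"
    using assms by auto
  have "p permutes {1..n-1} \<longleftrightarrow> p permutes {1..n} \<and> p n = n" for p
  proof (intro iffI conjI)
    assume p: "p permutes {1..n-1}"
    show "p permutes {1..n}" by (rule permutes_subset[OF p *(1)])
    show "p n = n" by (rule permutes_not_in[OF p *(2)])
  next
    assume p: "p permutes {1..n} \<and> p n = n"
    show "p permutes {1..n-1}"
      by (rule permutes_superset[OF conjunct1[OF p]]) (simp only: *(3) singleton_iff p)
  qed
  then show ?thesis by (simp only: set_eq_iff mem_Collect_eq alt_group_carrier) blast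
qed

end

theory Submission
  imports Defs
begin

text \<open>
  A product of \<open>k\<close> quads with disjoint supports is an involution that moves \<open>4 * k\<close> points. Two
  involutions of \<open>{1..n}\<close> with equally many moved points are conjugate in the symmetric group
  (\<open>involutions_conjugate\<close>), and if they are not the identity they are already conjugate in the
  alternating group, because a transposition that is one of the cycles of an involution centralises
  it. Hence the class consists of all involutions that move \<open>4 * k\<close> points
  (\<open>alt_group_conjugacy_class_eq\<close>), and its edges join commuting involutions whose product moves
  again \<open>4 * k\<close> points.

  Since transpositions generate the symmetric group, connectedness follows once every involution
  \<open>x\<close> of the class is joined by a path to each conjugate \<open>t \<circ> x \<circ> t\<close> by a transposition \<open>t\<close>. Such
  paths are explicit. On four points \<open>(a b)(c d)\<close>, \<open>(a c)(b d)\<close> and \<open>(a d)(b c)\<close> are pairwise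
  adjacent, and so every involution \<open>z\<close> with \<open>4 * j\<close> moved points has a neighbour \<open>w\<close> with the same
  support (\<open>adjacent_partner_exists\<close>). If \<open>t\<close> joins two cycles of \<open>x = (a b)(c d) z\<close>, then
  \<open>(a c)(b d) w\<close> is adjacent to both \<open>x\<close> and \<open>t \<circ> x \<circ> t\<close> (\<open>swap_within_support\<close>). If \<open>t\<close>
  exchanges a moved point with a fixed point, a path of length four works, provided that there is a
  second fixed point (\<open>replace_support_point\<close>). Both cases together cover \<open>n = 4 * k\<close>, where no point
  is fixed, and \<open>n \<ge> 4 * k + 2\<close>.

  For \<open>n = 4 * k + 1\<close> each element of the class has exactly one fixed point, and commuting elements
  have the same one. The components are therefore the \<open>n\<close> sets of all elements that fix a given
  point, each of which is connected by the case without fixed points.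
\<close>

section \<open>Involutions with a support of given size\<close>

definition involutions_on :: "'a set \<Rightarrow> nat \<Rightarrow> ('a \<Rightarrow> 'a) set" where
  "involutions_on S m = {x. x \<circ> x = id \<and> perm_supp x \<subseteq> S \<and> card (perm_supp x) = m}"

text \<open>
  This is the edge relation of the class graph: an involution is its own inverse, so the quotients
  \<open>x y\<inverse>\<close> and \<open>y x\<inverse>\<close> of two commuting involutions are both \<open>x \<circ> y\<close>. Distinctness of
  \<open>x\<close> and \<open>y\<close> is automatic for \<open>m > 0\<close>, since \<open>x \<circ> x\<close> moves no point. The ground set is a
  parameter because a path found on a small set is reused inside larger ones.
\<close>
definition adjacent :: "'a set \<Rightarrow> nat \<Rightarrow> ('a \<Rightarrow> 'a) \<Rightarrow> ('a \<Rightarrow> 'a) \<Rightarrow> bool" where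
  "adjacent S m x y \<longleftrightarrow> x \<in> involutions_on S m \<and> y \<in> involutions_on S m \<and>
    x \<circ> y = y \<circ> x \<and> x \<circ> y \<in> involutions_on S m"

abbreviation double_transposition :: "'a \<Rightarrow> 'a \<Rightarrow> 'a \<Rightarrow> 'a \<Rightarrow> 'a \<Rightarrow> 'a" where
  "double_transposition a b c d \<equiv> transpose a b \<circ> transpose c d"

lemma involutions_onD:
  assumes "x \<in> involutions_on S m"
  shows "x (x p) = p" "x p \<noteq> p \<Longrightarrow> p \<in> S" "perm_supp x \<subseteq> S" "card (perm_supp x) = m"
  using assms by (auto simp: involutions_on_def perm_supp_def fun_eq_iff)

lemma involutions_on_permutes:
  assumes "x \<in> involutions_on S m"
  shows "x permutes S"
  unfolding permutes_def using involutions_onD(1,2)[OF assms] by metis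

lemma involutions_on_mono:
  "x \<in> involutions_on S m \<Longrightarrow> S \<subseteq> T \<Longrightarrow> x \<in> involutions_on T m"
  by (auto simp: involutions_on_def)

lemma adjacent_mono: "adjacent S m x y \<Longrightarrow> S \<subseteq> T \<Longrightarrow> adjacent T m x y"
  by (auto simp: adjacent_def intro: involutions_on_mono)

lemma rtranclp_adjacent_mono:
  assumes "(adjacent S m)\<^sup>*\<^sup>* x y" "S \<subseteq> T"
  shows "(adjacent T m)\<^sup>*\<^sup>* x y"
  using assms(1) by (rule mono_rtranclp[rule_format, rotated]) (rule adjacent_mono[OF _ assms(2)])

lemma adjacent_sym: "adjacent S m x y \<Longrightarrow> adjacent S m y x"
  by (auto simp: adjacent_def)

lemma involutions_on_disjoint_commute:
  assumes "x \<in> involutions_on S l" "z \<in> involutions_on T m" "S \<inter> T = {}"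
  shows "x \<circ> z = z \<circ> x"
proof
  fix p
  note x = permutes_not_in[OF involutions_on_permutes[OF assms(1)]]
    permutes_in_image[OF involutions_on_permutes[OF assms(1)]]
  note z = permutes_not_in[OF involutions_on_permutes[OF assms(2)]]
    permutes_in_image[OF involutions_on_permutes[OF assms(2)]]
  show "(x \<circ> z) p = (z \<circ> x) p"
  proof (cases "p \<in> S")
    case True
    then have "p \<notin> T" "x p \<notin> T" using x(2)[of p] assms(3) by blast+
    then show ?thesis by (simp add: z(1))
  next
    case False
    then have "z p \<notin> S" using z[of p] assms(3) by (metis disjoint_iff)
    then show ?thesis using False by (simp add: x(1))
  qed
qed

lemma perm_supp_comp_disjoint:
  assumes "x \<in> involutions_on S l" "z \<in> involutions_on T m" "S \<inter> T = {}"
  shows "perm_supp (x \<circ> z) = perm_supp x \<union> perm_supp z"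
proof -
  note x = permutes_not_in[OF involutions_on_permutes[OF assms(1)]]
  note z = permutes_not_in[OF involutions_on_permutes[OF assms(2)]]
    permutes_in_image[OF involutions_on_permutes[OF assms(2)]]
  have "x (z p) \<noteq> p \<longleftrightarrow> x p \<noteq> p \<or> z p \<noteq> p" for p
  proof (cases "p \<in> S")
    case True
    then have "p \<notin> T" using assms(3) by blast
    then show ?thesis by (simp add: z(1))
  next
    case False
    then have "z p \<notin> S" using z[of p] assms(3) by (metis disjoint_iff)
    then show ?thesis using False by (simp add: x)
  qed
  then show ?thesis by (auto simp: perm_supp_def)
qed

lemma involutions_on_join:
  assumes "x \<in> involutions_on S l" "z \<in> involutions_on T m" "S \<inter> T = {}" "finite S" "finite T"
  shows "x \<circ> z \<in> involutions_on (S \<union> T) (l + m)"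
proof -
  note com = involutions_on_disjoint_commute[OF assms(1-3)]
  note supp = perm_supp_comp_disjoint[OF assms(1-3)]
  have "z (x p) = x (z p)" for p using com by (metis comp_apply)
  then have "(x \<circ> z) \<circ> (x \<circ> z) = id"
    using involutions_onD(1)[OF assms(1)] involutions_onD(1)[OF assms(2)]
    by (simp add: fun_eq_iff)
  moreover have "card (perm_supp x \<union> perm_supp z) = l + m"
    using involutions_onD(3,4)[OF assms(1)] involutions_onD(3,4)[OF assms(2)] assms(3-5)
    by (subst card_Un_disjoint) (auto intro: finite_subset)
  ultimately show ?thesis
    using involutions_onD(3)[OF assms(1)] involutions_onD(3)[OF assms(2)] supp
    by (auto simp: involutions_on_def)
qed

text \<open>
  Edges on disjoint sets multiply to an edge, because the factors on different sets commute and
  support sizes add. All edges below arise from an edge on four or six points and an edge on the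
  remaining part of the support.
\<close>
lemma adjacent_join:
  assumes "adjacent S l x y" "adjacent T m z w" "S \<inter> T = {}" "finite S" "finite T"
  shows "adjacent (S \<union> T) (l + m) (x \<circ> z) (y \<circ> w)"
proof -
  have c: "z \<circ> y = y \<circ> z" "w \<circ> x = x \<circ> w"
    using involutions_on_disjoint_commute[of y S l z T m]
      involutions_on_disjoint_commute[of x S l w T m] assms(1-3)
    by (simp_all add: adjacent_def)
  have c': "x \<circ> y = y \<circ> x" "z \<circ> w = w \<circ> z"
    using assms(1,2) by (auto simp: adjacent_def)
  have 1: "(x \<circ> z) \<circ> (y \<circ> w) = (x \<circ> y) \<circ> (z \<circ> w)"
    using c by (metis comp_assoc)
  have 2: "(y \<circ> w) \<circ> (x \<circ> z) = (x \<circ> y) \<circ> (z \<circ> w)"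
    using c c' by (metis comp_assoc)
  show ?thesis
    unfolding adjacent_def 1 2
    using assms involutions_on_join[of _ S l _ T m] by (auto simp: adjacent_def)
qed

section \<open>Edges on four and six points\<close>

lemma double_transposition_in_involutions_on:
  assumes "distinct [a, b, c, d]" "{a, b, c, d} \<subseteq> S"
  shows "double_transposition a b c d \<in> involutions_on S 4"
proof -
  have "perm_supp (double_transposition a b c d) = {a, b, c, d}"
    using assms(1) by (auto simp: perm_supp_def transpose_def)
  then show ?thesis
    using assms by (auto simp: involutions_on_def fun_eq_iff transpose_def)
qed

text \<open>
  The three double transpositions on four points are the involutions of a Klein four-group, so any
  two of them commute and multiply to the third.
\<close>
lemma adjacent_klein:
  assumes "distinct [a, b, c, d]" "{a, b, c, d} \<subseteq> S"
  shows "adjacent S 4 (double_transposition a b c d) (double_transposition a c b d)"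
proof -
  have prod: "double_transposition a b c d \<circ> double_transposition a c b d = double_transposition a d b c"
    "double_transposition a c b d \<circ> double_transposition a b c d = double_transposition a d b c"
    using assms(1) by (auto simp: fun_eq_iff transpose_def)
  show ?thesis
    unfolding adjacent_def prod
    using assms double_transposition_in_involutions_on[of a b c d S]
      double_transposition_in_involutions_on[of a c b d S]
      double_transposition_in_involutions_on[of a d b c S]
    by auto
qed

text \<open>
  On six points there is a second kind of edge, whose ends have different supports: the common
  transposition cancels in the product.
\<close>
lemma adjacent_shared_transposition:
  assumes "distinct [a, b, c, d, e, f]" "{a, b, c, d, e, f} \<subseteq> S"
  shows "adjacent S 4 (double_transposition a b e f) (double_transposition c d e f)"
proof -
  have prod: "double_transposition a b e f \<circ> double_transposition c d e f = double_transposition a b c d"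
    "double_transposition c d e f \<circ> double_transposition a b e f = double_transposition a b c d"
    using assms(1) by (auto simp: fun_eq_iff transpose_def)
  show ?thesis
    unfolding adjacent_def prod
    using assms by (simp add: double_transposition_in_involutions_on)
qed

section \<open>Removing cycles from an involution\<close>

lemma split_one_cycle:
  assumes "x \<in> involutions_on S m" "finite S" "x a \<noteq> a"
  obtains z where "z \<in> involutions_on (perm_supp x - {a, x a}) (m - 2)"
    "x = transpose a (x a) \<circ> z" "2 \<le> m" "\<And>p. p \<notin> {a, x a} \<Longrightarrow> z p = x p"
proof -
  note D = involutions_onD[OF assms(1)]
  define z where "z = transpose a (x a) \<circ> x"
  have inj: "x p = x q \<longleftrightarrow> p = q" for p q using D(1) by metis
  have z: "z p = (if p \<in> {a, x a} then p else x p)" for p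
    using D(1) inj[of p a] inj[of p "x a"] unfolding z_def by (auto simp: transpose_def)
  have supp: "perm_supp z = perm_supp x - {a, x a}"
    unfolding perm_supp_def by (auto simp: z)
  have sub: "{a, x a} \<subseteq> perm_supp x"
    using assms(3) D(1)[of a] by (auto simp: perm_supp_def)
  have "finite (perm_supp x)" using D(3) assms(2) finite_subset by blast
  moreover have "card {a, x a} = 2" using assms(3) by simp
  ultimately have card: "card (perm_supp z) = m - 2" "2 \<le> m"
    using card_Diff_subset[OF _ sub] card_mono[OF _ sub] D(4) by (auto simp: supp)
  have "z \<circ> z = id"
    using D(1) inj[of _ "x a"] inj[of _ a] by (auto simp: fun_eq_iff z)
  then have zin: "z \<in> involutions_on (perm_supp x - {a, x a}) (m - 2)"
    using card(1) by (simp add: involutions_on_def supp)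
  have prod: "x = transpose a (x a) \<circ> z"
    unfolding z_def by (simp add: fun_eq_iff)
  show thesis
    by (rule that[OF zin prod card(2)]) (simp add: z)
qed

lemma split_two_cycles:
  assumes "x \<in> involutions_on S m" "finite S" "x a \<noteq> a" "x c \<noteq> c" "c \<noteq> a" "c \<noteq> x a"
  obtains z where "z \<in> involutions_on (perm_supp x - {a, x a, c, x c}) (m - 4)"
    "x = double_transposition a (x a) c (x c) \<circ> z"
    "distinct [a, x a, c, x c]" "4 \<le> m" "{a, x a, c, x c} \<subseteq> S"
proof -
  note D = involutions_onD[OF assms(1)]
  have sub: "{a, x a, c, x c} \<subseteq> perm_supp x"
    using assms(3,4) D(1)[of a] D(1)[of c] by (auto simp: perm_supp_def)
  have "x c \<noteq> a" "x c \<noteq> x a" using assms(5,6) D(1) by metis+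
  then have dist: "distinct [a, x a, c, x c]"
    using assms(3-6) by auto
  obtain y where y: "y \<in> involutions_on (perm_supp x - {a, x a}) (m - 2)"
    "x = transpose a (x a) \<circ> y" "2 \<le> m" "y c = x c"
    using split_one_cycle[OF assms(1-3)] assms(5,6) by blast
  have fin: "finite (perm_supp x - {a, x a})" using D(3) assms(2) finite_subset by blast
  obtain z where z: "z \<in> involutions_on (perm_supp y - {c, x c}) (m - 2 - 2)"
    "y = transpose c (x c) \<circ> z" "2 \<le> m - 2"
    using split_one_cycle[OF y(1) fin, of c] assms(4) y(4) by metis
  have zin: "z \<in> involutions_on (perm_supp x - {a, x a, c, x c}) (m - 4)"
  proof (rule involutions_on_mono)
    show "z \<in> involutions_on (perm_supp y - {c, x c}) (m - 4)" using z(1) by simp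
  qed (use involutions_onD(3)[OF y(1)] in blast)
  have prod: "x = double_transposition a (x a) c (x c) \<circ> z"
    by (rule trans[OF y(2)]) (simp only: z(2) comp_assoc)
  show thesis
    by (rule that[OF zin prod dist _ subset_trans[OF sub D(3)]]) (use z(3) in linarith)
qed

text \<open>
  The cycles of \<open>z\<close> can be grouped in pairs, and on each pair \<open>(a b)(c d)\<close> the partner is taken to
  be \<open>(a c)(b d)\<close>. This is where the divisibility of the support size by four is used.
\<close>
lemma adjacent_partner_exists:
  assumes "z \<in> involutions_on S (4 * j)" "finite S"
  obtains w where "adjacent (perm_supp z) (4 * j) z w"
  using assms
proof (induction j arbitrary: z S thesis)
  case 0
  then have "finite (perm_supp z)" "card (perm_supp z) = 0"
    using involutions_onD(3,4) finite_subset by (metis, fastforce)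
  then have "z = id" by (auto simp: perm_supp_def)
  then have "adjacent (perm_supp z) (4 * 0) z id"
    by (auto simp: adjacent_def involutions_on_def perm_supp_def)
  then show ?case by (rule 0)
next
  case (Suc j)
  note D = involutions_onD[OF Suc.prems(2)]
  have fin: "finite (perm_supp z)" using D(3) Suc.prems finite_subset by blast
  obtain a where a: "z a \<noteq> a" using D(4) by (fastforce simp: perm_supp_def)
  have "\<not> perm_supp z \<subseteq> {a, z a}"
    using D(4) card_mono[of "{a, z a}" "perm_supp z"] by (auto simp: card_insert_if split: if_splits)
  then obtain c where c: "z c \<noteq> c" "c \<noteq> a" "c \<noteq> z a" by (auto simp: perm_supp_def)
  let ?B = "{a, z a, c, z c}"
  obtain u where u: "u \<in> involutions_on (perm_supp z - ?B) (4 * Suc j - 4)"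
    "z = double_transposition a (z a) c (z c) \<circ> u" "distinct [a, z a, c, z c]"
    using split_two_cycles[OF Suc.prems(2,3) a c] by blast
  have "u \<in> involutions_on (perm_supp z - ?B) (4 * j)" using u(1) by simp
  then obtain v where v: "adjacent (perm_supp u) (4 * j) u v"
    using Suc.IH fin by (metis finite_Diff)
  have uS: "perm_supp u \<subseteq> perm_supp z - ?B" using u(1) by (rule involutions_onD)
  have "adjacent (?B \<union> perm_supp u) (4 + 4 * j) (double_transposition a (z a) c (z c) \<circ> u)
      (double_transposition a c (z a) (z c) \<circ> v)"
  proof (rule adjacent_join[OF adjacent_klein[OF u(3) subset_refl] v])
    show "?B \<inter> perm_supp u = {}" using uS by blast
    show "finite (perm_supp u)" using finite_subset[OF uS] fin by blast
  qed simp
  moreover have "?B \<union> perm_supp u \<subseteq> perm_supp z"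
    using a c D(1) uS by (auto simp: perm_supp_def)
  ultimately have "adjacent (perm_supp z) (4 + 4 * j) (double_transposition a (z a) c (z c) \<circ> u)
      (double_transposition a c (z a) (z c) \<circ> v)"
    by (rule adjacent_mono)
  then show ?case using u(2) Suc.prems(1) by simp
qed

section \<open>Paths that realise one transposition\<close>

text \<open>
  The third double transposition \<open>(a c)(b d)\<close> on the four points, multiplied by a partner \<open>w\<close> of
  \<open>z\<close>, is a common neighbour of both ends.
\<close>
lemma swap_within_support:
  assumes "distinct [a, b, c, d]" "z \<in> involutions_on U (4 * j)" "finite U" "{a, b, c, d} \<inter> U = {}"
  shows "(adjacent ({a, b, c, d} \<union> U) (4 * Suc j))\<^sup>*\<^sup>*
    (double_transposition a b c d \<circ> z) (double_transposition a d b c \<circ> z)"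
proof -
  obtain w where "adjacent (perm_supp z) (4 * j) z w"
    using adjacent_partner_exists[OF assms(2,3)] by blast
  then have w: "adjacent U (4 * j) z w"
    using adjacent_mono involutions_onD(3)[OF assms(2)] by blast
  have 1: "adjacent {a, b, c, d} 4 (double_transposition a b c d) (double_transposition a c b d)"
    by (rule adjacent_klein[OF assms(1) subset_refl])
  have "adjacent {a, b, c, d} 4 (double_transposition a c d b) (double_transposition a d c b)"
    by (rule adjacent_klein) (use assms(1) in auto)
  then have 2: "adjacent {a, b, c, d} 4 (double_transposition a c b d) (double_transposition a d b c)"
    by (simp only: transpose_commute[of b d] transpose_commute[of b c])
  have "adjacent ({a, b, c, d} \<union> U) (4 + 4 * j)
      (double_transposition a b c d \<circ> z) (double_transposition a c b d \<circ> w)"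
    using adjacent_join[OF 1 w] assms(3,4) by simp
  moreover have "adjacent ({a, b, c, d} \<union> U) (4 + 4 * j)
      (double_transposition a c b d \<circ> w) (double_transposition a d b c \<circ> z)"
    using adjacent_join[OF 2 adjacent_sym[OF w]] assms(3,4) by simp
  ultimately show ?thesis by (simp add: rtranclp.rtrancl_into_rtrancl)
qed

text \<open>
  The path is
  \<open>(a b)(e f) z\<close>, \<open>(a b)(c d) w\<close>, \<open>(a c)(b d) z\<close>, \<open>(a d)(b c) w\<close>, \<open>(c b)(e f) z\<close>,
  where \<open>w\<close> is a partner of \<open>z\<close>. The first and the last edge exchange a transposition of the
  support for one on two fixed points, and the inner two edges rearrange the cycles in between so
  that the transposition given up at the end is not the one taken in at the start. Two fixed points
  \<open>c\<close> and \<open>d\<close> are needed, although only \<open>c\<close> enters the support of the last involution.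
\<close>
lemma replace_support_point:
  assumes "distinct [a, b, c, d, e, f]" "z \<in> involutions_on U (4 * j)" "finite U"
    "{a, b, c, d, e, f} \<inter> U = {}"
  shows "(adjacent ({a, b, c, d, e, f} \<union> U) (4 * Suc j))\<^sup>*\<^sup>*
    (double_transposition a b e f \<circ> z) (double_transposition c b e f \<circ> z)"
proof -
  obtain w where "adjacent (perm_supp z) (4 * j) z w"
    using adjacent_partner_exists[OF assms(2,3)] by blast
  then have w: "adjacent U (4 * j) z w"
    using adjacent_mono involutions_onD(3)[OF assms(2)] by blast
  let ?S = "{a, b, c, d, e, f}"
  have dist: "distinct [e, f, c, d, a, b]" "distinct [a, b, c, d]" "distinct [a, c, d, b]"
    "distinct [a, d, e, f, b, c]"
    using assms(1) by auto
  have base: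
    "adjacent ?S 4 (double_transposition e f a b) (double_transposition c d a b)"
    "adjacent ?S 4 (double_transposition a b c d) (double_transposition a c b d)"
    "adjacent ?S 4 (double_transposition a c d b) (double_transposition a d c b)"
    "adjacent ?S 4 (double_transposition a d b c) (double_transposition e f b c)"
    by (simp_all add: adjacent_shared_transposition[OF dist(1)] adjacent_klein[OF dist(2)]
        adjacent_klein[OF dist(3)] adjacent_shared_transposition[OF dist(4)])
  have com: "double_transposition e f a b = double_transposition a b e f"
    "double_transposition c d a b = double_transposition a b c d"
    "double_transposition e f b c = double_transposition c b e f"
    "double_transposition a c d b = double_transposition a c b d"
    "double_transposition a d c b = double_transposition a d b c"
    using assms(1) by (auto simp: fun_eq_iff transpose_def)
  have "adjacent (?S \<union> U) (4 + 4 * j)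
      (double_transposition a b e f \<circ> z) (double_transposition a b c d \<circ> w)"
    using adjacent_join[OF base(1) w] assms(3,4) by (simp add: com)
  moreover have "adjacent (?S \<union> U) (4 + 4 * j)
      (double_transposition a b c d \<circ> w) (double_transposition a c b d \<circ> z)"
    using adjacent_join[OF base(2) adjacent_sym[OF w]] assms(3,4) by simp
  moreover have "adjacent (?S \<union> U) (4 + 4 * j)
      (double_transposition a c b d \<circ> z) (double_transposition a d b c \<circ> w)"
    using adjacent_join[OF base(3) w] assms(3,4) by (simp add: com)
  moreover have "adjacent (?S \<union> U) (4 + 4 * j)
      (double_transposition a d b c \<circ> w) (double_transposition c b e f \<circ> z)"
    using adjacent_join[OF base(4) adjacent_sym[OF w]] assms(3,4) by (simp add: com)
  ultimately show ?thesis
    by (simp add: converse_rtranclp_into_rtranclp)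
qed

text \<open>
  An involution maps the pair \<open>{a, x a}\<close> to itself. For a moved point \<open>a\<close> the transposition is an
  odd permutation, and it serves to correct the parity of a permutation that conjugates \<open>x\<close>.
\<close>
lemma transpose_cycle_commute:
  assumes "x \<in> involutions_on S m"
  shows "transpose a (x a) \<circ> x = x \<circ> transpose a (x a)"
proof
  fix p
  note xx = involutions_onD(1)[OF assms]
  have "x p = a \<longleftrightarrow> p = x a" "x p = x a \<longleftrightarrow> p = a" using xx by metis+
  then show "(transpose a (x a) \<circ> x) p = (x \<circ> transpose a (x a)) p"
    by (auto simp: transpose_def xx)
qed

lemma transpose_commutes_outside:
  assumes "z \<in> involutions_on U m" "a \<notin> U" "c \<notin> U"
  shows "transpose a c \<circ> z = z \<circ> transpose a c"
proof
  fix p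
  note D = involutions_onD(1,2)[OF assms(1)]
  have "z a = a" "z c = c" using D(2) assms(2,3) by blast+
  moreover have "z p = a \<longleftrightarrow> p = a" "z p = c \<longleftrightarrow> p = c" using D(1) calculation by metis+
  ultimately show "(transpose a c \<circ> z) p = (z \<circ> transpose a c) p"
    by (auto simp: transpose_def)
qed

text \<open>
  If \<open>c\<close> lies in the cycle of \<open>a\<close>, conjugation changes nothing; if it lies in another cycle, the
  support stays the same; if it is fixed, then it replaces \<open>a\<close> in the support. In the last case the
  support is not all of \<open>S\<close>, so the condition on the cardinality provides the second fixed point
  that the path requires. For \<open>card S = 4 * k + 1\<close> this is the point that is missing.
\<close>
lemma conj_moved_by_transposition:
  assumes "finite S" "x \<in> involutions_on S (4 * k)" "a \<in> S" "c \<in> S" "x a \<noteq> a"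
    and card: "card S = 4 * k \<or> 4 * k + 2 \<le> card S"
  shows "(adjacent S (4 * k))\<^sup>*\<^sup>* x (transpose a c \<circ> x \<circ> transpose a c)"
proof -
  note D = involutions_onD[OF assms(2)]
  have fin: "finite (perm_supp x)" using D(3) assms(1) finite_subset by blast
  consider "c = a" | "c = x a" | "x c \<noteq> c" "c \<noteq> a" "c \<noteq> x a" | "x c = c" "c \<noteq> a" by blast
  then show ?thesis
  proof cases
    case 1 then show ?thesis by simp
  next
    case 2
    have "transpose a c \<circ> x \<circ> transpose a c = x"
      unfolding 2 transpose_cycle_commute[OF assms(2)] by (simp add: comp_assoc)
    then show ?thesis by simp
  next
    case 3
    obtain z where z: "z \<in> involutions_on (perm_supp x - {a, x a, c, x c}) (4 * k - 4)"
      "x = double_transposition a (x a) c (x c) \<circ> z"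
      "distinct [a, x a, c, x c]" "4 \<le> 4 * k" "{a, x a, c, x c} \<subseteq> S"
      using split_two_cycles[OF assms(2,1,5) 3] by blast
    let ?b = "x a" and ?d = "x c"
    let ?U = "perm_supp x - {a, ?b, c, ?d}"
    obtain j where j: "k = Suc j" using z(4) by (cases k) auto
    have path: "(adjacent ({a, ?b, c, ?d} \<union> ?U) (4 * Suc j))\<^sup>*\<^sup>*
        (double_transposition a ?b c ?d \<circ> z) (double_transposition a ?d ?b c \<circ> z)"
    proof (rule swap_within_support[OF z(3)])
      show "z \<in> involutions_on ?U (4 * j)" using z(1) j by simp
    qed (use fin in blast)+
    have "transpose a c \<circ> (double_transposition a ?b c ?d \<circ> z) \<circ> transpose a c
        = (transpose a c \<circ> double_transposition a ?b c ?d \<circ> transpose a c) \<circ> z"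
      using transpose_commutes_outside[OF z(1), of a c] by (simp add: comp_assoc)
    also have "transpose a c \<circ> double_transposition a ?b c ?d \<circ> transpose a c
        = double_transposition a ?d ?b c"
      using z(3) by (auto simp: fun_eq_iff transpose_def)
    finally have "transpose a c \<circ> x \<circ> transpose a c = double_transposition a ?d ?b c \<circ> z"
      by (simp only: z(2)[symmetric])
    moreover have "{a, ?b, c, ?d} \<union> ?U \<subseteq> S" using z(5) D(3) by auto
    ultimately show ?thesis
      using rtranclp_adjacent_mono[OF path] by (simp only: z(2)[symmetric] j[symmetric])
  next
    case 4
    let ?b = "x a"
    have "c \<in> S - perm_supp x" using 4 assms(4) by (auto simp: perm_supp_def)
    moreover have cardD: "card (S - perm_supp x) = card S - 4 * k"
      using D(3,4) fin by (simp add: card_Diff_subset)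
    ultimately have "0 < card (S - perm_supp x)"
      using assms(1) by (metis card_gt_0_iff empty_iff finite_Diff)
    then have "2 \<le> card (S - perm_supp x)" using card cardD by linarith
    then have "\<not> S - perm_supp x \<subseteq> {c}" using card_mono[of "{c}" "S - perm_supp x"] by auto
    then obtain d where d: "d \<in> S" "x d = d" "d \<noteq> c" by (auto simp: perm_supp_def)
    have "a \<in> perm_supp x" using assms(5) by (simp add: perm_supp_def)
    then have "0 < 4 * k" using fin D(4) card_gt_0_iff by (metis empty_iff)
    then obtain j where j: "k = Suc j" by (cases k) auto
    have "\<not> perm_supp x \<subseteq> {a, ?b}"
      using D(4) j card_mono[of "{a, ?b}" "perm_supp x"] by (auto simp: card_insert_if split: if_splits)
    then obtain e where e: "x e \<noteq> e" "e \<noteq> a" "e \<noteq> ?b" by (auto simp: perm_supp_def)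
    let ?f = "x e"
    obtain z where z: "z \<in> involutions_on (perm_supp x - {a, ?b, e, ?f}) (4 * k - 4)"
      "x = double_transposition a ?b e ?f \<circ> z"
      "distinct [a, ?b, e, ?f]" "{a, ?b, e, ?f} \<subseteq> S"
      using split_two_cycles[OF assms(2,1,5) e] by blast
    let ?U = "perm_supp x - {a, ?b, e, ?f}"
    have dist: "distinct [a, ?b, c, d, e, ?f]"
    proof -
      have moved: "x ?b \<noteq> ?b" "x ?f \<noteq> ?f" using D(1) assms(5) e(1) by metis+
      then have "p \<notin> {a, ?b, e, ?f}" if "x p = p" for p
        using that assms(5) e(1) by auto
      then have "c \<notin> {a, ?b, e, ?f}" "d \<notin> {a, ?b, e, ?f}" using 4(1) d(2) by blast+
      then show ?thesis using z(3) d(3) by auto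
    qed
    have path: "(adjacent ({a, ?b, c, d, e, ?f} \<union> ?U) (4 * Suc j))\<^sup>*\<^sup>*
        (double_transposition a ?b e ?f \<circ> z) (double_transposition c ?b e ?f \<circ> z)"
    proof (rule replace_support_point[OF dist])
      show "z \<in> involutions_on ?U (4 * j)" using z(1) j by simp
      show "{a, ?b, c, d, e, ?f} \<inter> ?U = {}" using 4 d by (auto simp: perm_supp_def)
    qed (use fin in blast)
    have "transpose a c \<circ> (double_transposition a ?b e ?f \<circ> z) \<circ> transpose a c
        = (transpose a c \<circ> double_transposition a ?b e ?f \<circ> transpose a c) \<circ> z"
      using transpose_commutes_outside[OF z(1), of a c] 4 by (simp add: comp_assoc perm_supp_def)
    also have "transpose a c \<circ> double_transposition a ?b e ?f \<circ> transpose a c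
        = double_transposition c ?b e ?f"
      using dist by (auto simp: fun_eq_iff transpose_def)
    finally have "transpose a c \<circ> x \<circ> transpose a c = double_transposition c ?b e ?f \<circ> z"
      by (simp only: z(2)[symmetric])
    moreover have "{a, ?b, c, d, e, ?f} \<union> ?U \<subseteq> S" using z(4) D(3) d assms(4) by auto
    ultimately show ?thesis
      using rtranclp_adjacent_mono[OF path] by (simp only: z(2)[symmetric] j[symmetric])
  qed
qed

lemma conj_by_transposition:
  assumes "finite S" "x \<in> involutions_on S (4 * k)" "a \<in> S" "c \<in> S"
    and "card S = 4 * k \<or> 4 * k + 2 \<le> card S"
  shows "(adjacent S (4 * k))\<^sup>*\<^sup>* x (transpose a c \<circ> x \<circ> transpose a c)"
proof -
  consider "x a \<noteq> a" | "x c \<noteq> c" | "x a = a" "x c = c" by blast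
  then show ?thesis
  proof cases
    case 1
    show ?thesis by (rule conj_moved_by_transposition[OF assms(1-4) 1 assms(5)])
  next
    case 2
    show ?thesis
      using conj_moved_by_transposition[OF assms(1,2,4,3) 2 assms(5)]
      by (simp only: transpose_commute[of a c])
  next
    case 3
    have "x \<in> involutions_on (perm_supp x) (4 * k)"
      using assms(2) by (simp add: involutions_on_def)
    then have "transpose a c \<circ> x = x \<circ> transpose a c"
      by (rule transpose_commutes_outside) (use 3 in \<open>simp_all add: perm_supp_def\<close>)
    then have "transpose a c \<circ> x \<circ> transpose a c = x"
      by (simp add: comp_assoc)
    then show ?thesis by simp
  qed
qed

section \<open>Conjugacy of involutions\<close>

lemma involutions_on_conj:
  assumes "x \<in> involutions_on S m" "g permutes S"
  shows "g \<circ> x \<circ> inv' g \<in> involutions_on S m"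
proof -
  note g = permutes_inverses[OF assms(2)]
  have "perm_supp (g \<circ> x \<circ> inv' g) = g ` perm_supp x"
  proof (rule subset_antisym; rule subsetI)
    fix p assume "p \<in> perm_supp (g \<circ> x \<circ> inv' g)"
    then have "inv' g p \<in> perm_supp x" using g(1) by (auto simp: perm_supp_def)
    then have "g (inv' g p) \<in> g ` perm_supp x" by (rule imageI)
    then show "p \<in> g ` perm_supp x" by (simp only: g(1))
  next
    fix p assume "p \<in> g ` perm_supp x"
    then show "p \<in> perm_supp (g \<circ> x \<circ> inv' g)"
      using g(2) permutes_inj[OF assms(2)] by (auto simp: perm_supp_def inj_def)
  qed
  moreover have "(g \<circ> x \<circ> inv' g) \<circ> (g \<circ> x \<circ> inv' g) = id"
    using g involutions_onD(1)[OF assms(1)] by (simp add: fun_eq_iff)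
  moreover have "g ` perm_supp x \<subseteq> S"
    using involutions_onD(3)[OF assms(1)] permutes_image[OF assms(2)] by blast
  moreover have "card (g ` perm_supp x) = m"
    using involutions_onD(4)[OF assms(1)] permutes_inj[OF assms(2)]
    by (subst card_image) (auto intro: inj_on_subset)
  ultimately show ?thesis by (simp add: involutions_on_def)
qed

section \<open>Connectedness of the adjacency relation\<close>

text \<open>
  Every permutation of a finite set is a product of transpositions, each of which can be followed
  along a path.
\<close>
lemma conj_reachable:
  assumes "finite S" "x \<in> involutions_on S (4 * k)" "g permutes S"
    and "card S = 4 * k \<or> 4 * k + 2 \<le> card S"
  shows "(adjacent S (4 * k))\<^sup>*\<^sup>* x (g \<circ> x \<circ> inv' g)"
  using assms(3,1)
proof (induction rule: permutes_induct)
  case id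
  show ?case by simp
next
  case (swap a b p)
  have "(adjacent S (4 * k))\<^sup>*\<^sup>* (p \<circ> x \<circ> inv' p)
      (transpose a b \<circ> (p \<circ> x \<circ> inv' p) \<circ> transpose a b)"
    by (rule conj_by_transposition[OF assms(1) involutions_on_conj[OF assms(2)]])
      (use swap assms(4) in auto)
  moreover have "inv' (transpose a b \<circ> p) = inv' p \<circ> transpose a b"
    using o_inv_distrib[of "transpose a b" p] permutes_bij[OF \<open>p permutes S\<close>] by simp
  ultimately show ?case
    using rtranclp_trans[OF swap.IH] by (simp only: comp_assoc)
qed

text \<open>
  Induction on the number of moved points: remove one cycle \<open>(a b)\<close> from \<open>x\<close> and one cycle
  \<open>(c d)\<close> from \<open>y\<close>. A permutation \<open>g\<close> that conjugates the rests sends \<open>a\<close> and \<open>b\<close> to fixed points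
  of the rest of \<open>y\<close>, and so it can be followed by transpositions of such fixed points that move
  these images to \<open>c\<close> and \<open>d\<close>.
\<close>
lemma involutions_conjugate:
  assumes "finite S" "x \<in> involutions_on S m" "y \<in> involutions_on S m"
  shows "\<exists>g. g permutes S \<and> g \<circ> x = y \<circ> g"
  using assms(2,3)
proof (induction m arbitrary: x y rule: less_induct)
  case (less m)
  note x = involutions_onD[OF less.prems(1)] and y = involutions_onD[OF less.prems(2)]
  show ?case
  proof (cases "m = 0")
    case True
    then have "perm_supp x = {}" "perm_supp y = {}"
      using x(3,4) y(3,4) assms(1) by (metis card_0_eq finite_subset)+
    then have "x = id" "y = id" by (auto simp: perm_supp_def)
    then have "id permutes S \<and> id \<circ> x = y \<circ> id" by (simp only: permutes_id)
    then show ?thesis by blast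
  next
    case False
    then have "perm_supp x \<noteq> {}" "perm_supp y \<noteq> {}" using x(4) y(4) by auto
    then obtain a c where a: "x a \<noteq> a" and c: "y c \<noteq> c" by (auto simp: perm_supp_def)
    let ?b = "x a" and ?d = "y c"
    have S: "a \<in> S" "?b \<in> S" "c \<in> S" "?d \<in> S" using x(1,2) y(1,2) a c by metis+
    obtain u where u: "u \<in> involutions_on (perm_supp x - {a, ?b}) (m - 2)" "x = transpose a ?b \<circ> u" "2 \<le> m"
      using split_one_cycle[OF less.prems(1) assms(1) a] by blast
    obtain v where v: "v \<in> involutions_on (perm_supp y - {c, ?d}) (m - 2)" "y = transpose c ?d \<circ> v"
      using split_one_cycle[OF less.prems(2) assms(1) c] by blast
    have uS: "u \<in> involutions_on S (m - 2)" and vS: "v \<in> involutions_on S (m - 2)"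
      using involutions_on_mono[OF u(1), of S] involutions_on_mono[OF v(1), of S] x(3) y(3) by blast+
    obtain g where g: "g permutes S" "g \<circ> u = v \<circ> g"
      using less.IH[OF _ uS vS] u(3) by (metis diff_less less_le_trans zero_less_numeral)
    have ufix: "u a = a" "u ?b = ?b" using involutions_onD(2)[OF u(1)] by blast+
    have vfix: "v c = c" "v ?d = ?d" using involutions_onD(2)[OF v(1)] by blast+
    have gfix: "v (g a) = g a" "v (g ?b) = g ?b"
      using ufix g(2) by (metis comp_apply)+
    have vv: "v \<in> involutions_on (perm_supp v) (m - 2)" using vS by (simp add: involutions_on_def)
    have commute: "transpose p q \<circ> v = v \<circ> transpose p q" if "v p = p" "v q = q" for p q
      by (rule transpose_commutes_outside[OF vv]) (use that in \<open>simp_all add: perm_supp_def\<close>)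
    (* The first transposition brings g a to c and may displace g b; r is where g b then lies. *)
    define r where "r = transpose (g a) c (g ?b)"
    define h where "h = transpose r ?d \<circ> transpose (g a) c \<circ> g"
    have "v r = r" unfolding r_def transpose_def using gfix vfix by simp
    have gS: "g a \<in> S" "g ?b \<in> S" using S permutes_in_image[OF g(1)] by blast+
    then have "r \<in> S" using S by (simp add: r_def transpose_def)
    have h: "h permutes S"
      unfolding h_def using g(1) S gS \<open>r \<in> S\<close>
      by (intro permutes_compose permutes_swap_id)
    have "r \<noteq> c" using permutes_inj[OF g(1)] a by (auto simp: r_def transpose_def inj_def)
    then have hab: "h a = c" "h ?b = ?d" using c by (auto simp: h_def r_def[symmetric])
    have "h \<circ> u = v \<circ> h"
    proof -
      have "h \<circ> u = transpose r ?d \<circ> (transpose (g a) c \<circ> v) \<circ> g"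
        by (simp add: h_def comp_assoc g(2))
      also have "\<dots> = (transpose r ?d \<circ> v) \<circ> transpose (g a) c \<circ> g"
        by (simp only: commute[OF gfix(1) vfix(1)] comp_assoc)
      also have "\<dots> = v \<circ> h"
        by (simp only: commute[OF \<open>v r = r\<close> vfix(2)] comp_assoc h_def)
      finally show ?thesis .
    qed
    moreover have "transpose c ?d \<circ> h = h \<circ> transpose a ?b"
    proof -
      have "inv' h c = a" "inv' h ?d = ?b" using permutes_inv_eq[OF h] hab by blast+
      then show ?thesis using transpose_comp_eq[OF permutes_bij[OF h], of c ?d] by (simp only:)
    qed
    ultimately have "h \<circ> (transpose a ?b \<circ> u) = (transpose c ?d \<circ> v) \<circ> h"
      by (metis comp_assoc)
    then have "h \<circ> x = y \<circ> h" by (simp only: u(2)[symmetric] v(2)[symmetric])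
    then show ?thesis using h by blast
  qed
qed

text \<open>
  The class of such an involution does not split in the alternating group, since its centraliser
  contains an odd permutation.
\<close>
lemma involutions_conjugate_evenperm:
  assumes "finite S" "x \<in> involutions_on S m" "y \<in> involutions_on S m" "m > 0"
  obtains g where "g permutes S" "evenperm g" "g \<circ> x = y \<circ> g"
proof -
  note D = involutions_onD[OF assms(2)]
  obtain g where g: "g permutes S" "g \<circ> x = y \<circ> g"
    using involutions_conjugate[OF assms(1-3)] by blast
  show thesis
  proof (cases "evenperm g")
    case True
    then show ?thesis using that g by blast
  next
    case False
    have "perm_supp x \<noteq> {}" using D(4) assms(4) by auto
    then obtain a where a: "x a \<noteq> a" by (auto simp: perm_supp_def)
    let ?t = "transpose a (x a)"
    have "a \<in> S" "x a \<in> S" using D(1,2) a by metis+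
    then have t: "?t permutes S" by (rule permutes_swap_id)
    have "\<not> evenperm ?t" using a by (simp add: evenperm_swap)
    then have "evenperm (g \<circ> ?t)"
      using False evenperm_comp[of g ?t] permutes_imp_permutation[OF assms(1)] g(1) t by blast
    moreover have "?t \<circ> x = x \<circ> ?t"
      by (rule transpose_cycle_commute[OF assms(2)])
    then have "(g \<circ> ?t) \<circ> x = y \<circ> (g \<circ> ?t)"
      using g(2) by (metis comp_assoc)
    ultimately show ?thesis using that permutes_compose[OF t g(1)] by blast
  qed
qed

lemma involutions_on_reachable:
  assumes "finite S" "x \<in> involutions_on S (4 * k)" "y \<in> involutions_on S (4 * k)"
    and "card S = 4 * k \<or> 4 * k + 2 \<le> card S"
  shows "(adjacent S (4 * k))\<^sup>*\<^sup>* x y"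
proof -
  obtain g where g: "g permutes S" "g \<circ> x = y \<circ> g"
    using involutions_conjugate[OF assms(1-3)] by blast
  then have "g \<circ> x \<circ> inv' g = y"
    by (simp add: comp_assoc permutes_inv_o)
  then show ?thesis using conj_reachable[OF assms(1,2) g(1) assms(4)] by simp
qed

section \<open>The conjugacy class and its graph\<close>

lemma disjoint_quad_product_involution:
  assumes "disjoint_quad_product k x"
  shows "x \<in> involutions_on (perm_supp x) (4 * k)"
proof -
  have quad: "finite (perm_supp q) \<and> q \<in> involutions_on (perm_supp q) 4"
    if q: "quad q" for q :: "'a \<Rightarrow> 'a"
  proof -
    obtain a b c d where d: "distinct [a, b, c, d]" and q: "q = double_transposition a b c d"
      using q by (auto simp: quad_def)
    have "q \<in> involutions_on {a, b, c, d} 4"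
      unfolding q by (rule double_transposition_in_involutions_on[OF d subset_refl])
    then show ?thesis
      using finite_subset[of "perm_supp q" "{a, b, c, d}"] by (auto simp: involutions_on_def)
  qed
  have "foldr (\<circ>) qs id \<in> involutions_on (\<Union>q\<in>set qs. perm_supp q) (4 * length qs)"
    if "\<forall>q\<in>set qs. quad q" "sorted_wrt (\<lambda>q r. perm_supp q \<inter> perm_supp r = {}) qs"
    for qs :: "('a \<Rightarrow> 'a) list"
    using that
  proof (induction qs)
    case Nil
    show ?case by (simp add: involutions_on_def perm_supp_def fun_eq_iff)
  next
    case (Cons q qs)
    have "q \<circ> foldr (\<circ>) qs id
        \<in> involutions_on (perm_supp q \<union> (\<Union>q\<in>set qs. perm_supp q)) (4 + 4 * length qs)"
    proof (rule involutions_on_join)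
      show "foldr (\<circ>) qs id \<in> involutions_on (\<Union>q\<in>set qs. perm_supp q) (4 * length qs)"
        by (rule Cons.IH) (use Cons.prems in simp_all)
    qed (use Cons.prems quad in auto)
    moreover have "foldr (\<circ>) (q # qs) id = q \<circ> foldr (\<circ>) qs id" by simp
    ultimately show ?case by (simp only: list.set UN_insert length_Cons mult_Suc_right)
  qed
  then obtain qs :: "('a \<Rightarrow> 'a) list"
    where "x \<in> involutions_on (\<Union>q\<in>set qs. perm_supp q) (4 * k)"
    using assms unfolding disjoint_quad_product_def by metis
  then show ?thesis by (simp add: involutions_on_def)
qed

lemma alt_group_conjugacy_class_eq:
  assumes "k \<ge> 1" "C \<in> conjugacy_classes (alt_group n)"
    and "\<And>x. x \<in> C \<Longrightarrow> disjoint_quad_product k x"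
  shows "C = involutions_on {1..n} (4 * k)" "C \<noteq> {}" "C \<subseteq> carrier (alt_group n)"
proof -
  obtain x where x: "x \<in> carrier (alt_group n)"
    and C: "C = {(\<lambda>h\<in>carrier (alt_group n). g \<circ> h \<circ> inv\<^bsub>alt_group n\<^esub> g) x | g. g \<in> carrier (alt_group n)}"
    using assms(2) by (auto simp: conjugacy_classes_def orbits_def orbit_def alt_group_mult)
  have C: "C = {g \<circ> x \<circ> inv' g | g. g \<in> carrier (alt_group n)}"
    unfolding C using x by (intro Collect_cong iff_exI) (auto simp: alt_group_inv_equality)
  have "id \<in> carrier (alt_group n)" by (simp only: alt_group_carrier permutes_id evenperm_id)
  then have "id \<circ> x \<circ> inv' id \<in> C" unfolding C by blast
  then have xC: "x \<in> C" by simp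
  show "C \<noteq> {}" using xC by blast
  have "x permutes {1..n}" using x by (simp add: alt_group_carrier)
  then have "perm_supp x \<subseteq> {1..n}"
    using permutes_not_in by (fastforce simp: perm_supp_def)
  then have xI: "x \<in> involutions_on {1..n} (4 * k)"
    using disjoint_quad_product_involution[OF assms(3)[OF xC]]
    by (rule involutions_on_mono[rotated])
  show "C = involutions_on {1..n} (4 * k)"
  proof (rule subset_antisym; rule subsetI)
    fix y assume "y \<in> C"
    then show "y \<in> involutions_on {1..n} (4 * k)"
      using involutions_on_conj[OF xI] by (auto simp: C alt_group_carrier)
  next
    fix y assume "y \<in> involutions_on {1..n} (4 * k)"
    then obtain g where g: "g permutes {1..n}" "evenperm g" "g \<circ> x = y \<circ> g"
      using involutions_conjugate_evenperm[OF _ xI] assms(1) by auto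
    then have "y = g \<circ> x \<circ> inv' g" by (simp add: comp_assoc permutes_inv_o)
    then show "y \<in> C" using g(1,2) by (auto simp: C alt_group_carrier)
  qed
  interpret group "alt_group n" by (rule alt_group_is_group)
  show "C \<subseteq> carrier (alt_group n)"
  proof
    fix y assume "y \<in> C"
    then obtain g where "g \<in> carrier (alt_group n)" "y = g \<otimes>\<^bsub>alt_group n\<^esub> x \<otimes>\<^bsub>alt_group n\<^esub> inv\<^bsub>alt_group n\<^esub> g"
      by (auto simp: C alt_group_mult alt_group_inv_equality)
    then show "y \<in> carrier (alt_group n)" using x by simp
  qed
qed

lemma parcs_class_graph:
  assumes "C = involutions_on {1..n} m" "C \<subseteq> carrier (alt_group n)" "m > 0"
  shows "parcs (class_graph (alt_group n) C) = {(x, y). adjacent {1..n} m x y}"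
proof -
  have inv: "inv\<^bsub>alt_group n\<^esub> x = x" if "x \<in> C" for x
  proof -
    have "x \<circ> x = id" using that assms(1) by (simp add: involutions_on_def)
    then have "inv' x = x" using inv_unique_comp by blast
    then show ?thesis using alt_group_inv_equality that assms(2) by auto
  qed
  have ne: "x \<noteq> y" if "adjacent {1..n} m x y" for x y
  proof
    assume "x = y"
    then have "x \<circ> x \<in> involutions_on {1..n} m" "x \<in> involutions_on {1..n} m"
      using that by (simp_all only: adjacent_def)
    moreover from this(2) have "x \<circ> x = id" by (simp add: involutions_on_def)
    ultimately have "id \<in> involutions_on {1..n} m" by (simp only:)
    then show False using assms(3) by (simp add: involutions_on_def perm_supp_def)
  qed
  show ?thesis
  proof (rule subset_antisym; rule subrelI)
    fix x y assume "(x, y) \<in> parcs (class_graph (alt_group n) C)"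
    then have xy: "x \<in> C" "y \<in> C" "x \<circ> y = y \<circ> x"
      "x \<circ> inv\<^bsub>alt_group n\<^esub> y \<in> C \<or> y \<circ> inv\<^bsub>alt_group n\<^esub> x \<in> C"
      by (simp_all add: class_graph_def alt_group_mult)
    then have "x \<circ> y \<in> C" using inv by metis
    then have "adjacent {1..n} m x y"
      using xy(1-3) unfolding adjacent_def assms(1) by blast
    then show "(x, y) \<in> {(x, y). adjacent {1..n} m x y}" by simp
  next
    fix x y assume "(x, y) \<in> {(x, y). adjacent {1..n} m x y}"
    then have adj: "adjacent {1..n} m x y" by simp
    then have "x \<in> C" "y \<in> C" "x \<circ> y = y \<circ> x" "x \<circ> y \<in> C"
      unfolding adjacent_def assms(1) by blast+
    then show "(x, y) \<in> parcs (class_graph (alt_group n) C)"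
      using ne[OF adj] by (simp add: class_graph_def alt_group_mult inv)
  qed
qed

lemma rtranclp_adjacent_in:
  assumes "(adjacent S m)\<^sup>*\<^sup>* x y" "x \<in> involutions_on S m"
  shows "y \<in> involutions_on S m"
  using assms by induction (auto simp: adjacent_def)

lemma reachable_class_graph_iff:
  assumes "C = involutions_on {1..n} m" "C \<subseteq> carrier (alt_group n)" "m > 0"
  shows "x \<rightarrow>\<^sup>*\<^bsub>with_proj (class_graph (alt_group n) C)\<^esub> y \<longleftrightarrow> x \<in> C \<and> (adjacent {1..n} m)\<^sup>*\<^sup>* x y"
proof -
  let ?G = "class_graph (alt_group n) C"
  interpret G: pair_bidirected_digraph ?G by (rule class_graph_bidirected)
  have V: "pverts ?G = C" by (simp add: class_graph_def)
  have "x \<rightarrow>\<^sup>*\<^bsub>with_proj ?G\<^esub> y \<longleftrightarrow> (x, y) \<in> {(x, y). adjacent {1..n} m x y}\<^sup>* \<and> x \<in> C \<and> y \<in> C"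
    by (simp add: G.reachable_conv V parcs_class_graph[OF assms])
  then show ?thesis
    using rtranclp_adjacent_in[of "{1..n}" m x y] assms(1)
    by (auto simp: rtranclp_rtrancl_eq[symmetric])
qed

lemma connected_class_graph:
  assumes "k \<ge> 1" "C = involutions_on {1..n} (4 * k)" "C \<noteq> {}" "C \<subseteq> carrier (alt_group n)"
    and "n = 4 * k \<or> 4 * k + 2 \<le> n"
  shows "connected (class_graph (alt_group n) C)"
proof -
  let ?G = "class_graph (alt_group n) C"
  interpret G: pair_bidirected_digraph ?G by (rule class_graph_bidirected)
  have V: "pverts ?G = C" by (simp add: class_graph_def)
  have "x \<rightarrow>\<^sup>*\<^bsub>with_proj ?G\<^esub> y" if "x \<in> C" "y \<in> C" for x y
  proof -
    have "(adjacent {1..n} (4 * k))\<^sup>*\<^sup>* x y"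
      by (rule involutions_on_reachable) (use that assms(2,5) in simp_all)
    moreover have "0 < 4 * k" using assms(1) by simp
    ultimately show ?thesis using reachable_class_graph_iff[OF assms(2,4)] that(1) by blast
  qed
  then show ?thesis
    unfolding connected_def
    by (intro strongly_connectedI) (simp_all add: V assms(3) G.reachable_mk_symmetricI)
qed

section \<open>Components when exactly one point is fixed\<close>

lemma unique_fixed_point:
  assumes "x \<in> involutions_on S m" "finite S" "card S = Suc m"
  shows "\<exists>i\<in>S. \<forall>p\<in>S. x p = p \<longleftrightarrow> p = i"
proof -
  note D = involutions_onD[OF assms(1)]
  have "card (S - perm_supp x) = 1"
    using D(3,4) assms(2,3) by (simp add: card_Diff_subset finite_subset)
  then obtain i where "S - perm_supp x = {i}" by (auto simp: card_1_singleton_iff)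
  then show ?thesis unfolding perm_supp_def by blast
qed

lemma involutions_on_remove_point:
  assumes "i \<in> S"
  shows "involutions_on (S - {i}) m = {x \<in> involutions_on S m. x i = i}"
  using assms by (auto simp: involutions_on_def perm_supp_def)

text \<open>
  A permutation that commutes with \<open>x\<close> permutes the fixed points of \<open>x\<close>, and here there is only one.
\<close>
lemma adjacent_same_fixed_point:
  assumes "(adjacent S m)\<^sup>*\<^sup>* x y" "x i = i" "i \<in> S" "finite S" "card S = Suc m"
  shows "y i = i"
  using assms(1,2)
proof induction
  case base
  then show ?case .
next
  case (step y z)
  have y: "y \<in> involutions_on S m" and z: "z \<in> involutions_on S m" and com: "y \<circ> z = z \<circ> y"
    using step.hyps(2) by (auto simp: adjacent_def)
  have "y (z i) = z i" using step.IH[OF step.prems] com by (metis comp_apply)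
  moreover have "z i \<in> S"
    using permutes_in_image[OF involutions_on_permutes[OF z]] assms(3) by blast
  ultimately show ?case
    using unique_fixed_point[OF y assms(4,5)] step.IH[OF step.prems] assms(3) by metis
qed

lemma involutions_on_remove_point_nonempty:
  assumes "x \<in> involutions_on S m" "finite S" "card S = Suc m" "i \<in> S"
  shows "involutions_on (S - {i}) m \<noteq> {}"
proof -
  obtain j where j: "j \<in> S" "x j = j" using unique_fixed_point[OF assms(1-3)] by blast
  let ?t = "transpose i j"
  have "?t \<circ> x \<circ> inv' ?t \<in> involutions_on S m"
    by (rule involutions_on_conj[OF assms(1) permutes_swap_id[OF assms(4) j(1)]])
  moreover have "(?t \<circ> x \<circ> inv' ?t) i = i" using j(2) by simp
  ultimately show ?thesis using involutions_on_remove_point[OF assms(4)] by blast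
qed

text \<open>
  Fixing \<open>i\<close> amounts to acting on the remaining \<open>4 * k\<close> points without fixed points, so the
  involutions that fix \<open>i\<close> are connected with each other by the case of full support.
\<close>
lemma component_verts_class_graph:
  assumes "k \<ge> 1" "C = involutions_on {1..4 * k + 1} (4 * k)" "C \<noteq> {}"
    and "C \<subseteq> carrier (alt_group (4 * k + 1))"
  shows "component_verts (class_graph (alt_group (4 * k + 1)) C)
    = (\<lambda>i. {x \<in> C. x i = i}) ` {1..4 * k + 1}"
proof -
  let ?n = "4 * k + 1"
  let ?G = "class_graph (alt_group ?n) C" and ?F = "\<lambda>i. {x \<in> C. x i = i}"
  interpret G: pair_bidirected_digraph ?G by (rule class_graph_bidirected)
  have reach: "x \<rightarrow>\<^sup>*\<^bsub>with_proj ?G\<^esub> y \<longleftrightarrow> x \<in> C \<and> (adjacent {1..?n} (4 * k))\<^sup>*\<^sup>* x y" for x y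
    using reachable_class_graph_iff[OF assms(2,4)] assms(1) by simp
  have scc: "?F i \<in> G.sccs_verts" if i: "i \<in> {1..?n}" for i
  proof -
    have F: "?F i = involutions_on ({1..?n} - {i}) (4 * k)"
      using involutions_on_remove_point[OF i] assms(2) by simp
    obtain x where "x \<in> C" using assms(3) by blast
    then have "?F i \<noteq> {}"
      unfolding F using involutions_on_remove_point_nonempty[of x "{1..?n}" "4 * k"] i assms(2) by simp
    moreover have "x \<rightarrow>\<^sup>*\<^bsub>with_proj ?G\<^esub> y" if xy: "x \<in> ?F i" "y \<in> ?F i" for x y
    proof -
      have "(adjacent ({1..?n} - {i}) (4 * k))\<^sup>*\<^sup>* x y"
        using xy unfolding F by (intro involutions_on_reachable) (use i in auto)
      then show ?thesis using xy reach rtranclp_adjacent_mono[of "{1..?n} - {i}"] by blast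
    qed
    moreover have "y \<in> ?F i" if "x \<in> ?F i" "x \<rightarrow>\<^sup>*\<^bsub>with_proj ?G\<^esub> y" for x y
    proof -
      have path: "(adjacent {1..?n} (4 * k))\<^sup>*\<^sup>* x y" and x: "x \<in> C" "x i = i" using that reach by blast+
      have "y i = i" by (rule adjacent_same_fixed_point[OF path x(2) i]) simp_all
      moreover have "y \<in> C" using rtranclp_adjacent_in[OF path] x(1) assms(2) by simp
      ultimately show ?thesis by simp
    qed
    ultimately show ?thesis unfolding G.in_sccs_verts_conv_reachable by blast
  qed
  have "T \<in> ?F ` {1..?n}" if T: "T \<in> G.sccs_verts" for T
  proof -
    obtain x where x: "x \<in> T" "x \<in> C"
      using T reach unfolding G.in_sccs_verts_conv_reachable by blast
    then obtain i where i: "i \<in> {1..?n}" "x i = i"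
      using unique_fixed_point[of x "{1..?n}" "4 * k"] assms(2) by auto
    then have "x \<in> T \<inter> ?F i" using x by blast
    then have "T = ?F i" using G.sccs_verts_disjoint[OF T scc[OF i(1)]] by blast
    then show ?thesis using i by blast
  qed
  then show ?thesis unfolding component_verts_def using scc by blast
qed

theorem proposition3p4:
  fixes k n :: nat and C :: "(nat \<Rightarrow> nat) set"
  assumes "k \<ge> 1"
    and "C \<in> conjugacy_classes (alt_group n)"
    and "\<And>x. x \<in> C \<Longrightarrow> disjoint_quad_product k x"
  shows "(n = 4 * k \<longrightarrow> connected (class_graph (alt_group n) C)) \<and>
    (n \<ge> 4 * k + 2 \<longrightarrow> connected (class_graph (alt_group n) C)) \<and>
    (n = 4 * k + 1 \<longrightarrow>
      card (component_verts (class_graph (alt_group n) C)) = n \<and>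
      C \<inter> carrier (alt_group (n - 1)) \<in> component_verts (class_graph (alt_group n) C))"
proof -
  have C: "C = involutions_on {1..n} (4 * k)" "C \<noteq> {}" "C \<subseteq> carrier (alt_group n)"
    using alt_group_conjugacy_class_eq[OF assms(1,2)] assms(3) by blast+
  have "card (component_verts (class_graph (alt_group n) C)) = n \<and>
      C \<inter> carrier (alt_group (n - 1)) \<in> component_verts (class_graph (alt_group n) C)"
    if n: "n = 4 * k + 1"
  proof
    let ?F = "\<lambda>i. {x \<in> C. x i = i}"
    have comps: "component_verts (class_graph (alt_group n) C) = ?F ` {1..n}"
      using component_verts_class_graph[OF assms(1)] C unfolding n by blast
    have "inj_on ?F {1..n}"
    proof (rule inj_onI)
      fix i j assume ij: "i \<in> {1..n}" "j \<in> {1..n}" "?F i = ?F j"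
      obtain x where "x \<in> C" using C(2) by blast
      then have "?F i \<noteq> {}"
        using involutions_on_remove_point_nonempty[of x "{1..n}" "4 * k" i]
          involutions_on_remove_point[OF ij(1), of "4 * k"] C(1) ij(1) n by simp
      then obtain y where "y \<in> C" "y i = i" "y j = j" using ij(3) by blast
      then show "i = j"
        using unique_fixed_point[of y "{1..n}" "4 * k"] C(1) ij(1,2) n by auto
    qed
    then show "card (component_verts (class_graph (alt_group n) C)) = n"
      unfolding comps by (simp add: card_image)
    have "C \<inter> carrier (alt_group (n - 1)) = ?F n"
      using alt_group_pred_carrier[of n] C(3) n by auto
    then show "C \<inter> carrier (alt_group (n - 1)) \<in> component_verts (class_graph (alt_group n) C)"
      unfolding comps using n by simp
  qed
  then show ?thesis using connected_class_graph[OF assms(1) C] by blast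
qed

end
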